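(* Let $\mathbf U_0$ be the rational Urysohn space. Then $\mathrm{Aut}(\mathbf U_0)$ has a dense conjugacy class. Thus, as $\mathrm{Aut}(\mathbf U_0)$ can be continuously, densely embedded into $\mathrm{Iso}(\mathbf U)$, the isometry group of the Urysohn space $\mathbf U$, the group $\mathrm{Iso}(\mathbf U)$ also has a dense conjugacy class.
   Context: The rational Urysohn space $\mathbf U_0$ is the Fraïssé limit of the class of finite metric spaces with rational distances, i.e. the unique (up to isometry) countable metric space with rational distances which contains an isometric copy of every finite metric space with rational distances and in which every isometry between finite subsets extends to a surjective isometry of the whole space. $\mathrm{Aut}(\mathbf U_0)=\mathrm{Iso}(\mathbf U_0)$ is its group of surjective isometries, with the topology of pointwise convergence where $\mathbf U_0$ is given the discrete topology. The Urysohn space $\mathbf U$ is the completion of $\mathbf U_0$ (the universal ultrahomogeneous Polish metric space), and $\mathrm{Iso}(\mathbf U)$ is its group of surjective isometries with the topology of pointwise convergence (with respect to the metric of $\mathbf U$). "Continuously, densely embedded" means there is an injective continuous homomorphism with dense image. *)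

theory Defs
  imports "HOL-Analysis.Analysis" "HOL-Algebra.Bij"
begin

definition isometric_embedding :: "'a metric \<Rightarrow> 'b metric \<Rightarrow> ('a \<Rightarrow> 'b) \<Rightarrow> bool" where
  "isometric_embedding m m' f \<longleftrightarrow>
     f \<in> mspace m \<rightarrow> mspace m' \<and>
     (\<forall>x\<in>mspace m. \<forall>y\<in>mspace m. mdist m' (f x) (f y) = mdist m x y)"

definition rational_metric :: "'a metric \<Rightarrow> bool" where
  "rational_metric m \<longleftrightarrow> (\<forall>x\<in>mspace m. \<forall>y\<in>mspace m. mdist m x y \<in> \<rat>)"

text \<open>Elements are extensional (\<open>undefined\<close> outside \<open>mspace m\<close>), so that equality of
  group elements is equality of maps on \<open>mspace m\<close>; the product is composition.\<close>

definition isometry_group :: "'a metric \<Rightarrow> ('a \<Rightarrow> 'a) monoid" where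
  "isometry_group m =
     (BijGroup (mspace m)) \<lparr>carrier := {g \<in> Bij (mspace m). isometric_embedding m m g}\<rparr>"

text \<open>The topology of pointwise convergence on the isometry group, where \<open>X\<close> is the topology
  that the underlying set \<open>mspace m\<close> is given: the metric topology or the discrete one.\<close>

definition pointwise_topology :: "'a metric \<Rightarrow> 'a topology \<Rightarrow> ('a \<Rightarrow> 'a) topology" where
  "pointwise_topology m X =
     subtopology (product_topology (\<lambda>_. X) (mspace m)) (carrier (isometry_group m))"

text \<open>Every finite metric space is isometric to one whose points are natural numbers, so it
  suffices to quantify over \<open>nat metric\<close> in the universality clause.\<close>

definition rational_urysohn_space :: "'a metric \<Rightarrow> bool" where
  "rational_urysohn_space m \<longleftrightarrow>
     countable (mspace m) \<and> rational_metric m \<and>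
     (\<forall>F :: nat metric. finite (mspace F) \<and> rational_metric F \<longrightarrow>
        (\<exists>f. isometric_embedding F m f)) \<and>
     (\<forall>A f. A \<subseteq> mspace m \<and> finite A \<and> isometric_embedding (submetric m A) m f \<longrightarrow>
        (\<exists>g\<in>carrier (isometry_group m). \<forall>x\<in>A. g x = f x))"

definition is_completion :: "'a metric \<Rightarrow> 'b metric \<Rightarrow> bool" where
  "is_completion m M \<longleftrightarrow>
     mcomplete_of M \<and>
     (\<exists>e. isometric_embedding m M e \<and> mtopology_of M closure_of (e ` mspace m) = mspace M)"

definition conjugacy_class :: "('g, 'r) monoid_scheme \<Rightarrow> 'g \<Rightarrow> 'g set" where
  "conjugacy_class G g = {h \<otimes>\<^bsub>G\<^esub> g \<otimes>\<^bsub>G\<^esub> inv\<^bsub>G\<^esub> h | h. h \<in> carrier G}"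

definition has_dense_conjugacy_class :: "('g, 'r) monoid_scheme \<Rightarrow> 'g topology \<Rightarrow> bool" where
  "has_dense_conjugacy_class G T \<longleftrightarrow>
     (\<exists>g\<in>carrier G. T closure_of (conjugacy_class G g) = topspace T)"

definition continuously_densely_embeds ::
  "('g, 'r) monoid_scheme \<Rightarrow> 'g topology \<Rightarrow> ('h, 's) monoid_scheme \<Rightarrow> 'h topology \<Rightarrow> bool" where
  "continuously_densely_embeds G S H T \<longleftrightarrow>
     (\<exists>\<phi>\<in>hom G H. inj_on \<phi> (carrier G) \<and> continuous_map S T \<phi> \<and>
        T closure_of (\<phi> ` carrier G) = topspace T)"

lemma subgroup_isometry_group:
  "subgroup (carrier (isometry_group m)) (BijGroup (mspace m))"
proof -
  let ?B = "BijGroup (mspace m)"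
  interpret B: group ?B by (rule group_BijGroup)
  let ?H = "carrier (isometry_group m)"
  have H: "?H = {g \<in> Bij (mspace m). isometric_embedding m m g}"
    by (simp add: isometry_group_def)
  show ?thesis
  proof (rule B.subgroupI)
    show "?H \<subseteq> carrier ?B" by (auto simp: H BijGroup_def)
    have "(\<lambda>x\<in>mspace m. x) \<in> ?H" by (auto simp: H id_Bij isometric_embedding_def)
    then show "?H \<noteq> {}" by blast
  next
    fix g assume "g \<in> ?H"
    then have g: "g \<in> Bij (mspace m)" and iso: "isometric_embedding m m g" by (auto simp: H)
    let ?k = "\<lambda>x\<in>mspace m. inv_into (mspace m) g x"
    have mem: "inv_into (mspace m) g x \<in> mspace m" "g (inv_into (mspace m) g x) = x"
      if "x \<in> mspace m" for x
      using that g Bij_inv_into_mem[OF g that]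
      by (auto simp: Bij_def bij_betw_def f_inv_into_f)
    have "isometric_embedding m m ?k"
      using iso mem unfolding isometric_embedding_def by (auto, metis)
    then show "inv\<^bsub>?B\<^esub> g \<in> ?H"
      using g by (simp add: H inv_BijGroup restrict_inv_into_Bij)
  next
    fix g h assume "g \<in> ?H" "h \<in> ?H"
    then show "g \<otimes>\<^bsub>?B\<^esub> h \<in> ?H"
      by (auto simp: H BijGroup_def compose_Bij isometric_embedding_def compose_eq Pi_iff)
  qed
qed

lemma group_isometry_group: "group (isometry_group m)"
proof -
  have "group ((BijGroup (mspace m)) \<lparr>carrier := carrier (isometry_group m)\<rparr>)"
    by (intro group.subgroup_imp_group group_BijGroup subgroup_isometry_group)
  then show ?thesis by (simp add: isometry_group_def)
qed

lemma topspace_pointwise_topology: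
  "topspace X = mspace m \<Longrightarrow> topspace (pointwise_topology m X) = carrier (isometry_group m)"
  by (auto simp: pointwise_topology_def isometry_group_def Bij_def PiE_def bij_betw_def)

end

theory Submission
  imports Defs
begin

text \<open>
  Everything rests on one extension property of the rational Urysohn space \<open>U0\<close>. Finite sets
  \<open>E\<close> and \<open>F\<close> in \<open>U0\<close> can be placed at any prescribed positive rational cross-distances
  compatible with the triangle inequality: some automorphism \<open>h\<close> moves \<open>F\<close> to the required
  position relative to the fixed set \<open>E\<close> (\<open>rational_urysohn_prescribed_distances\<close>). Universality
  realises the amalgam of \<open>E\<close> and \<open>F\<close>, and homogeneity puts it where it belongs.

  For the first claim the cross-distance is a constant larger than all distances that occur.
  Given a finite partial isometry \<open>q\<close> with domain and range in \<open>E\<close>, and another one \<open>p\<close> with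
  domain and range in \<open>F\<close>, the union of \<open>q\<close> and the conjugate of \<open>p\<close> by \<open>h\<close> is then again a
  partial isometry, so it extends to an automorphism (\<open>rational_urysohn_extend_by_conjugate\<close>).
  There are only countably many finite partial isometries \<open>p\<close>. A back-and-forth construction,
  in the form of a Baire category statement (\<open>countable_metric_generic_isometry\<close>), gives one
  automorphism \<open>g\<close> that contains a conjugate of each of them. Conversely, every \<open>p\<close> is then
  contained in a conjugate of \<open>g\<close>, which says that the conjugacy class of \<open>g\<close> is dense.

  For the second claim, every automorphism of \<open>U0\<close> extends uniquely to an isometry of the
  completion \<open>U\<close>; uniqueness makes the extension a homomorphism. Density of its image is again
  an amalgamation: an isometry \<open>f\<close> of \<open>U\<close> moves a finite set \<open>F\<close> in \<open>U0\<close> to points that have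
  approximations \<open>w\<close> in \<open>U0\<close>, and \<open>w\<close> distorts distances only slightly. Amalgamating \<open>F\<close> with
  the points \<open>w x\<close>, each \<open>x\<close> being close to its \<open>w x\<close>, yields an automorphism of \<open>U0\<close> close to
  \<open>f\<close> on \<open>F\<close> (\<open>rational_urysohn_approximate_isometry\<close>).

  Finally, a continuous homomorphism with dense image maps a dense conjugacy class into a dense
  one (\<open>dense_conjugacy_class_transfer\<close>).
\<close>

section \<open>Isometry groups and the topology of pointwise convergence\<close>

lemma mdist_self: "x \<in> mspace m \<Longrightarrow> mdist m x x = 0"
  by simp

lemma isometry_group_carrier_iff:
  "g \<in> carrier (isometry_group m) \<longleftrightarrow>
     g \<in> extensional (mspace m) \<and> bij_betw g (mspace m) (mspace m) \<and> isometric_embedding m m g"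
  by (auto simp: isometry_group_def Bij_def)

lemma isometry_groupD:
  assumes "g \<in> carrier (isometry_group m)"
  shows "x \<in> mspace m \<Longrightarrow> g x \<in> mspace m"
    and "\<lbrakk>x \<in> mspace m; y \<in> mspace m\<rbrakk> \<Longrightarrow> mdist m (g x) (g y) = mdist m x y"
    and "g ` mspace m = mspace m"
  using assms by (auto simp: isometry_group_carrier_iff isometric_embedding_def bij_betw_def)

lemma isometry_group_eqI:
  assumes "g \<in> carrier (isometry_group m)" "h \<in> carrier (isometry_group m)"
    and "\<And>x. x \<in> mspace m \<Longrightarrow> g x = h x"
  shows "g = h"
  using assms by (meson extensionalityI isometry_group_carrier_iff)

lemma isometric_embedding_inj_on:
  assumes "isometric_embedding m m' f"
  shows "inj_on f (mspace m)"
proof (rule inj_onI)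
  fix x y assume xy: "x \<in> mspace m" "y \<in> mspace m" "f x = f y"
  then have "mdist m x y = mdist m' (f x) (f x)"
    using assms unfolding isometric_embedding_def by metis
  also have "\<dots> = 0"
    using assms xy by (auto simp: isometric_embedding_def Pi_iff)
  finally show "x = y" using xy by simp
qed

lemma isometry_groupI:
  assumes "isometric_embedding m m f" "mspace m \<subseteq> f ` mspace m"
  shows "restrict f (mspace m) \<in> carrier (isometry_group m)"
proof -
  have "f ` mspace m = mspace m"
    using assms by (auto simp: isometric_embedding_def)
  then have "bij_betw f (mspace m) (mspace m)"
    using isometric_embedding_inj_on[OF assms(1)] by (simp add: bij_betw_def)
  then have "bij_betw (restrict f (mspace m)) (mspace m) (mspace m)"
    by (simp cong: bij_betw_cong)
  then show ?thesis
    using assms(1) by (auto simp: isometry_group_carrier_iff isometric_embedding_def)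
qed

lemma isometry_group_mult_apply:
  assumes "g \<in> carrier (isometry_group m)" "h \<in> carrier (isometry_group m)" "x \<in> mspace m"
  shows "(g \<otimes>\<^bsub>isometry_group m\<^esub> h) x = g (h x)"
  using assms by (simp add: isometry_group_def BijGroup_def compose_eq)

lemma isometry_group_inv_apply:
  assumes g: "g \<in> carrier (isometry_group m)" and x: "x \<in> mspace m"
  shows "(inv\<^bsub>isometry_group m\<^esub> g) (g x) = x" "g ((inv\<^bsub>isometry_group m\<^esub> g) x) = x"
proof -
  interpret group "isometry_group m" by (rule group_isometry_group)
  have "\<one>\<^bsub>isometry_group m\<^esub> x = x"
    using x by (simp add: isometry_group_def BijGroup_def)
  then show "(inv\<^bsub>isometry_group m\<^esub> g) (g x) = x" "g ((inv\<^bsub>isometry_group m\<^esub> g) x) = x"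
    using isometry_group_mult_apply[OF g inv_closed[OF g] x]
      isometry_group_mult_apply[OF inv_closed[OF g] g x] g by auto
qed

text \<open>A conjugate by \<open>h\<close> is the same map with all points renamed by \<open>h\<close>. This is the only way in
  which conjugation is used below.\<close>

lemma isometry_group_conjugate_apply:
  assumes "g \<in> carrier (isometry_group m)" "h \<in> carrier (isometry_group m)" "x \<in> mspace m"
  shows "(h \<otimes>\<^bsub>isometry_group m\<^esub> g \<otimes>\<^bsub>isometry_group m\<^esub> inv\<^bsub>isometry_group m\<^esub> h) (h x) = h (g x)"
proof -
  interpret group "isometry_group m" by (rule group_isometry_group)
  show ?thesis
    using assms by (simp add: isometry_group_mult_apply isometry_group_inv_apply isometry_groupD)
qed

text \<open>A basic open set of the product topology restricts only finitely many coordinates, so density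
  has to be tested on finite sets of points only.\<close>

lemma dense_in_pointwise_topologyI:
  assumes X: "topspace X = mspace m" and S: "S \<subseteq> carrier (isometry_group m)"
    and approx: "\<And>f A U. \<lbrakk>f \<in> carrier (isometry_group m); finite A; A \<subseteq> mspace m;
        \<And>x. x \<in> A \<Longrightarrow> openin X (U x) \<and> f x \<in> U x\<rbrakk> \<Longrightarrow> \<exists>g\<in>S. \<forall>x\<in>A. g x \<in> U x"
  shows "pointwise_topology m X closure_of S = topspace (pointwise_topology m X)"
  unfolding dense_intersects_open
proof (intro allI impI)
  fix T assume T: "openin (pointwise_topology m X) T \<and> T \<noteq> {}"
  then obtain W f where W: "openin (product_topology (\<lambda>_. X) (mspace m)) W"
    and TW: "T = W \<inter> carrier (isometry_group m)" and f: "f \<in> T"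
    by (auto simp: pointwise_topology_def openin_subtopology)
  then have "f \<in> W" by blast
  with W have "\<exists>U. finite {x \<in> mspace m. U x \<noteq> topspace X} \<and>
      (\<forall>x\<in>mspace m. openin X (U x)) \<and> f \<in> Pi\<^sub>E (mspace m) U \<and> Pi\<^sub>E (mspace m) U \<subseteq> W"
    unfolding openin_product_topology_alt by (rule bspec)
  then obtain U where fin: "finite {x \<in> mspace m. U x \<noteq> topspace X}"
    and U: "\<forall>x\<in>mspace m. openin X (U x)"
    and fU: "f \<in> Pi\<^sub>E (mspace m) U" and UW: "Pi\<^sub>E (mspace m) U \<subseteq> W"
    by (elim exE conjE) (rule that)
  have "\<exists>g\<in>S. \<forall>x\<in>{x \<in> mspace m. U x \<noteq> topspace X}. g x \<in> U x"
    using f TW fin U fU by (intro approx) auto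
  then obtain g where g: "g \<in> S" "\<And>x. \<lbrakk>x \<in> mspace m; U x \<noteq> topspace X\<rbrakk> \<Longrightarrow> g x \<in> U x"
    by blast
  have gc: "g \<in> carrier (isometry_group m)" using g S by blast
  have "g \<in> Pi\<^sub>E (mspace m) U"
  proof (rule PiE_I)
    fix x assume "x \<in> mspace m"
    then show "g x \<in> U x"
      using g(2)[of x] isometry_groupD(1)[OF gc, of x] X by (cases "U x = topspace X") auto
  next
    fix x assume "x \<notin> mspace m"
    moreover have "g \<in> extensional (mspace m)"
      using gc by (simp add: isometry_group_carrier_iff)
    ultimately show "g x = undefined" by (metis extensional_arb)
  qed
  then show "S \<inter> T \<noteq> {}" using UW TW gc g(1) by blast
qed

lemma dense_in_pointwise_metric_topologyI:
  assumes S: "S \<subseteq> carrier (isometry_group m)"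
    and approx: "\<And>f A \<epsilon>. \<lbrakk>f \<in> carrier (isometry_group m); finite A; A \<subseteq> mspace m; \<epsilon> > 0\<rbrakk>
        \<Longrightarrow> \<exists>g\<in>S. \<forall>x\<in>A. mdist m (f x) (g x) < \<epsilon>"
  shows "pointwise_topology m (mtopology_of m) closure_of S
       = topspace (pointwise_topology m (mtopology_of m))"
proof (rule dense_in_pointwise_topologyI)
  fix f A U
  assume f: "f \<in> carrier (isometry_group m)" and A: "finite A" "A \<subseteq> mspace m"
    and U: "\<And>x. x \<in> A \<Longrightarrow> openin (mtopology_of m) (U x) \<and> f x \<in> U x"
  interpret Metric_space "mspace m" "mdist m" by simp
  have "\<exists>r>0. mball (f x) r \<subseteq> U x" if "x \<in> A" for x
    using U[OF that] by (auto simp: mtopology_of_def openin_mtopology)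
  then obtain r where r: "\<And>x. x \<in> A \<Longrightarrow> r x > 0 \<and> mball (f x) (r x) \<subseteq> U x" by metis
  define \<epsilon> where "\<epsilon> = Min (insert 1 (r ` A))"
  have "\<epsilon> > 0" and \<epsilon>: "\<And>x. x \<in> A \<Longrightarrow> \<epsilon> \<le> r x"
    using A(1) r by (auto simp: \<epsilon>_def)
  then obtain g where g: "g \<in> S" "\<And>x. x \<in> A \<Longrightarrow> mdist m (f x) (g x) < \<epsilon>"
    using approx[OF f A] by blast
  have "g x \<in> U x" if x: "x \<in> A" for x
  proof -
    have "g x \<in> mball (f x) (r x)"
      using g S A(2) x f \<epsilon>[OF x] by (fastforce simp: isometry_groupD)
    then show ?thesis using r[OF x] by blast
  qed
  then show "\<exists>g\<in>S. \<forall>x\<in>A. g x \<in> U x" using g(1) by blast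
qed (use S in auto)

text \<open>A homomorphism maps the class of \<open>g\<close> into the class of its image, and a continuous map with
  dense image maps dense sets to dense sets.\<close>

lemma dense_conjugacy_class_transfer:
  assumes emb: "continuously_densely_embeds G S H T"
    and dense: "has_dense_conjugacy_class G S"
    and G: "group G" "topspace S = carrier G" and H: "group H" "topspace T = carrier H"
  shows "has_dense_conjugacy_class H T"
proof -
  interpret G: group G by fact
  interpret H: group H by fact
  obtain \<phi> where hom: "\<phi> \<in> hom G H" and cont: "continuous_map S T \<phi>"
    and \<phi>: "T closure_of (\<phi> ` carrier G) = topspace T"
    using emb by (auto simp: continuously_densely_embeds_def)
  interpret \<phi>: group_hom G H \<phi> by unfold_locales (rule hom)
  obtain g where g: "g \<in> carrier G" and cl: "S closure_of (conjugacy_class G g) = topspace S"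
    using dense by (auto simp: has_dense_conjugacy_class_def)
  have "\<phi> ` conjugacy_class G g \<subseteq> conjugacy_class H (\<phi> g)"
    using g by (fastforce simp: conjugacy_class_def)
  then have "T closure_of (\<phi> ` conjugacy_class G g) \<subseteq> T closure_of (conjugacy_class H (\<phi> g))"
    by (rule closure_of_mono)
  then have "\<phi> ` carrier G \<subseteq> T closure_of (conjugacy_class H (\<phi> g))"
    using continuous_map_image_closure_subset[OF cont, of "conjugacy_class G g"] cl G(2) by auto
  then have "T closure_of (\<phi> ` carrier G) \<subseteq> T closure_of (conjugacy_class H (\<phi> g))"
    by (simp add: closure_of_minimal)
  then have "T closure_of (conjugacy_class H (\<phi> g)) = topspace T"
    using \<phi> closure_of_subset_topspace[of T] by blast
  then show ?thesis
    using g by (auto simp: has_dense_conjugacy_class_def)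
qed

section \<open>Amalgamation inside the rational Urysohn space\<close>

text \<open>Universality is defined for spaces of natural numbers. Numbering the points gives it
  for an arbitrary finite carrier, with the metric axioms required on that carrier only.\<close>

lemma rational_urysohn_universal:
  fixes D :: "'c \<Rightarrow> 'c \<Rightarrow> real"
  assumes U0: "rational_urysohn_space U0" and fin: "finite M"
    and rat: "\<And>x y. \<lbrakk>x \<in> M; y \<in> M\<rbrakk> \<Longrightarrow> D x y \<in> \<rat>"
    and nonneg: "\<And>x y. \<lbrakk>x \<in> M; y \<in> M\<rbrakk> \<Longrightarrow> 0 \<le> D x y"
    and sym: "\<And>x y. \<lbrakk>x \<in> M; y \<in> M\<rbrakk> \<Longrightarrow> D x y = D y x"
    and zero: "\<And>x y. \<lbrakk>x \<in> M; y \<in> M\<rbrakk> \<Longrightarrow> D x y = 0 \<longleftrightarrow> x = y"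
    and triangle: "\<And>x y z. \<lbrakk>x \<in> M; y \<in> M; z \<in> M\<rbrakk> \<Longrightarrow> D x z \<le> D x y + D y z"
  shows "\<exists>j\<in>M \<rightarrow> mspace U0. \<forall>x\<in>M. \<forall>y\<in>M. mdist U0 (j x) (j y) = D x y"
proof -
  obtain t :: "'c \<Rightarrow> nat" where t: "inj_on t M"
    using fin finite_imp_inj_to_nat_seg by blast
  define s where "s = inv_into M t"
  have st: "s (t x) = x" if "x \<in> M" for x
    using t that by (simp add: s_def)
  define N where "N = t ` M"
  have tN: "t x \<in> N" if "x \<in> M" for x using that by (simp add: N_def)
  have sM: "s i \<in> M" if "i \<in> N" for i using that st by (auto simp: N_def)
  have s_inj: "s i = s j \<longleftrightarrow> i = j" if "i \<in> N" "j \<in> N" for i j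
    using that st by (auto simp: N_def)
  \<comment> \<open>The type of metrics requires symmetry and nonnegativity everywhere, hence the value 0 off
    the carrier.\<close>
  define D' where "D' i j = (if i \<in> N \<and> j \<in> N then D (s i) (s j) else 0)" for i j
  interpret Metric_space N D'
  proof
    show "D' i j = D' j i" for i j
      by (simp add: D'_def sym[OF sM sM, of i j])
  qed (auto simp: D'_def sM nonneg zero triangle s_inj)
  have "rational_metric (metric (N, D'))"
    by (auto simp: rational_metric_def D'_def sM rat)
  moreover have "finite N" using fin by (simp add: N_def)
  then have "finite (mspace (metric (N, D')))" by simp
  ultimately obtain f where "isometric_embedding (metric (N, D')) U0 f"
    using U0 unfolding rational_urysohn_space_def by blast
  then have "f \<circ> t \<in> M \<rightarrow> mspace U0" "\<forall>x\<in>M. \<forall>y\<in>M. mdist U0 ((f \<circ> t) x) ((f \<circ> t) y) = D x y"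
    by (auto simp: isometric_embedding_def tN D'_def st)
  then show ?thesis by blast
qed

lemma rational_urysohn_homogeneous:
  assumes "rational_urysohn_space U0" "finite A" "A \<subseteq> mspace U0" "f \<in> A \<rightarrow> mspace U0"
    and "\<And>x y. \<lbrakk>x \<in> A; y \<in> A\<rbrakk> \<Longrightarrow> mdist U0 (f x) (f y) = mdist U0 x y"
  obtains g where "g \<in> carrier (isometry_group U0)" "\<And>x. x \<in> A \<Longrightarrow> g x = f x"
proof -
  have "isometric_embedding (submetric U0 A) U0 f"
    using assms(3-5) by (auto simp: isometric_embedding_def)
  then show ?thesis
    using assms(1-3) that unfolding rational_urysohn_space_def by metis
qed

text \<open>The four inequalities are the triangle inequalities for the disjoint union of \<open>E\<close> and \<open>F\<close>
  with cross-distance \<open>c\<close>. A copy of that union exists in \<open>U0\<close> by universality. Homogeneity is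
  used twice: once to move the copy of \<open>E\<close> back onto \<open>E\<close>, and once to extend to an automorphism
  the isometry from \<open>F\<close> to its displaced copy.\<close>

lemma rational_urysohn_prescribed_distances:
  fixes c :: "'a \<Rightarrow> 'a \<Rightarrow> real"
  assumes U0: "rational_urysohn_space U0"
    and E: "finite E" "E \<subseteq> mspace U0" and F: "finite F" "F \<subseteq> mspace U0"
    and c: "\<And>x y. \<lbrakk>x \<in> E; y \<in> F\<rbrakk> \<Longrightarrow> c x y \<in> \<rat> \<and> 0 < c x y"
    and E_lip: "\<And>x x' y. \<lbrakk>x \<in> E; x' \<in> E; y \<in> F\<rbrakk> \<Longrightarrow> c x y \<le> mdist U0 x x' + c x' y"
    and F_lip: "\<And>x y y'. \<lbrakk>x \<in> E; y \<in> F; y' \<in> F\<rbrakk> \<Longrightarrow> c x y \<le> c x y' + mdist U0 y' y"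
    and E_tri: "\<And>x x' y. \<lbrakk>x \<in> E; x' \<in> E; y \<in> F\<rbrakk> \<Longrightarrow> mdist U0 x x' \<le> c x y + c x' y"
    and F_tri: "\<And>x y y'. \<lbrakk>x \<in> E; y \<in> F; y' \<in> F\<rbrakk> \<Longrightarrow> mdist U0 y y' \<le> c x y + c x y'"
  obtains h where "h \<in> carrier (isometry_group U0)"
    "\<And>x y. \<lbrakk>x \<in> E; y \<in> F\<rbrakk> \<Longrightarrow> mdist U0 x (h y) = c x y"
proof -
  let ?d = "mdist U0" and ?G = "isometry_group U0"
  interpret group ?G by (rule group_isometry_group)
  define D where "D = (\<lambda>p q. case p of
      Inl x \<Rightarrow> (case q of Inl x' \<Rightarrow> ?d x x' | Inr y \<Rightarrow> c x y)
    | Inr y \<Rightarrow> (case q of Inl x \<Rightarrow> c x y | Inr y' \<Rightarrow> ?d y y'))"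
  have rat: "?d x y \<in> \<rat>" if "x \<in> mspace U0" "y \<in> mspace U0" for x y
    using U0 that by (auto simp: rational_urysohn_space_def rational_metric_def)
  have EF: "x \<in> E \<Longrightarrow> x \<in> mspace U0" "x \<in> F \<Longrightarrow> x \<in> mspace U0" for x
    using E F by auto
  have c': "c x y \<in> \<rat>" "0 < c x y" "0 \<le> c x y" "c x y \<noteq> 0" if "x \<in> E" "y \<in> F" for x y
    using c[OF that] by auto
  have "\<exists>j\<in>E <+> F \<rightarrow> mspace U0. \<forall>p\<in>E <+> F. \<forall>q\<in>E <+> F. ?d (j p) (j q) = D p q"
  proof (rule rational_urysohn_universal[OF U0])
    have E_lip': "c x' y \<le> c x y + ?d x x'" if "x \<in> E" "x' \<in> E" "y \<in> F" for x x' y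
      using E_lip[OF that(2,1,3)] mdist_commute[of U0 x x'] by linarith
    have F_lip': "c x y \<le> ?d y y' + c x y'" if "x \<in> E" "y \<in> F" "y' \<in> F" for x y y'
      using F_lip[OF that] mdist_commute[of U0 y y'] by linarith
    fix p q r assume "p \<in> E <+> F" "q \<in> E <+> F" "r \<in> E <+> F"
    then show "D p r \<le> D p q + D q r"
      by (auto simp: D_def EF mdist_triangle E_lip F_lip E_tri F_tri E_lip' F_lip')
  qed (use E F in \<open>auto simp: D_def rat EF c' mdist_commute\<close>)
  then obtain j where j: "j \<in> E <+> F \<rightarrow> mspace U0"
    and jD: "\<And>p q. \<lbrakk>p \<in> E <+> F; q \<in> E <+> F\<rbrakk> \<Longrightarrow> ?d (j p) (j q) = D p q"
    by blast
  have jE: "?d (j (Inl x)) (j (Inl x')) = ?d x x'" if "x \<in> E" "x' \<in> E" for x x'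
    using jD[OF InlI[OF that(1)] InlI[OF that(2)]] by (simp add: D_def)
  have jF: "?d (j (Inr y)) (j (Inr y')) = ?d y y'" if "y \<in> F" "y' \<in> F" for y y'
    using jD[OF InrI[OF that(1)] InrI[OF that(2)]] by (simp add: D_def)
  have jEF: "?d (j (Inl x)) (j (Inr y)) = c x y" if "x \<in> E" "y \<in> F" for x y
    using jD[OF InlI[OF that(1)] InrI[OF that(2)]] by (simp add: D_def)
  have jm: "x \<in> E \<Longrightarrow> j (Inl x) \<in> mspace U0" "y \<in> F \<Longrightarrow> j (Inr y) \<in> mspace U0" for x y
    using j by auto
  \<comment> \<open>The inverse of \<open>k\<close> returns the copy of \<open>E\<close> to \<open>E\<close>; \<open>h\<close> then follows the copy of \<open>F\<close>.\<close>
  obtain k where k: "k \<in> carrier ?G" "\<And>x. x \<in> E \<Longrightarrow> k x = j (Inl x)"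
    by (rule rational_urysohn_homogeneous[OF U0 E, of "\<lambda>x. j (Inl x)"])
       (use jm jE in auto)
  let ?k' = "inv\<^bsub>?G\<^esub> k"
  have k': "?k' \<in> carrier ?G" using k by simp
  obtain h where h: "h \<in> carrier ?G" "\<And>y. y \<in> F \<Longrightarrow> h y = ?k' (j (Inr y))"
    by (rule rational_urysohn_homogeneous[OF U0 F, of "\<lambda>y. ?k' (j (Inr y))"])
       (use jm jF k' in \<open>auto simp: isometry_groupD\<close>)
  have "?d x (h y) = c x y" if "x \<in> E" "y \<in> F" for x y
  proof -
    have "?k' (j (Inl x)) = x"
      using isometry_group_inv_apply(1)[OF k(1) EF(1)[OF that(1)]] k(2)[OF that(1)] by simp
    then have "?d x (h y) = ?d (?k' (j (Inl x))) (?k' (j (Inr y)))"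
      using h that by simp
    also have "\<dots> = ?d (j (Inl x)) (j (Inr y))"
      using that k' jm by (simp add: isometry_groupD)
    finally show ?thesis using jEF that by simp
  qed
  with h(1) show thesis by (rule that)
qed

section \<open>A dense conjugacy class for the rational Urysohn space\<close>

text \<open>This is the Baire category theorem for the isometry group of a countable metric space with
  the topology of pointwise convergence in the discrete sense: countably many properties, each
  of which can be forced on an open set inside any given basic open set, hold simultaneously for
  some isometry. The isometry is the limit of \<open>g n\<close>, where \<open>g (Suc n)\<close> agrees with \<open>g n\<close> on a
  finite set \<open>S n\<close>. These sets exhaust the space and so do their images, which makes the limit
  defined everywhere and surjective.\<close>

lemma countable_metric_generic_isometry:
  fixes P :: "nat \<Rightarrow> ('a \<Rightarrow> 'a) \<Rightarrow> bool"
  assumes cnt: "countable (mspace m)"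
    and step: "\<And>n g S. \<lbrakk>g \<in> carrier (isometry_group m); finite S; S \<subseteq> mspace m\<rbrakk> \<Longrightarrow>
      \<exists>g'\<in>carrier (isometry_group m). \<exists>T. finite T \<and> T \<subseteq> mspace m \<and> (\<forall>x\<in>S. g' x = g x) \<and>
        (\<forall>f\<in>carrier (isometry_group m). (\<forall>x\<in>T. f x = g' x) \<longrightarrow> P n f)"
  obtains g where "g \<in> carrier (isometry_group m)" "\<And>n. P n g"
proof -
  let ?G = "isometry_group m"
  interpret group ?G by (rule group_isometry_group)
  let ?N = "to_nat_on (mspace m)"
  \<comment> \<open>An exhaustion by finite sets: step \<open>n\<close> puts \<open>B n\<close> into the domain and the range.\<close>
  define B where "B = (\<lambda>n. {x \<in> mspace m. ?N x < n})"
  have finB: "finite (B n)" for n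
  proof (rule finite_imageD)
    show "finite (?N ` B n)" by (rule finite_subset[of _ "{..<n}"]) (auto simp: B_def)
    show "inj_on ?N (B n)"
      using inj_on_to_nat_on[OF cnt] by (rule inj_on_subset) (auto simp: B_def)
  qed
  have Bm: "B n \<subseteq> mspace m" for n by (auto simp: B_def)
  define I where "I = (\<lambda>(g, S). g \<in> carrier ?G \<and> finite S \<and> S \<subseteq> mspace m)"
  define R where "R = (\<lambda>n (g, S) (g', S').
      (\<forall>x\<in>S. g' x = g x) \<and> S \<union> B n \<subseteq> S' \<and> B n \<subseteq> g' ` S' \<and>
      (\<forall>f\<in>carrier ?G. (\<forall>x\<in>S'. f x = g' x) \<longrightarrow> P n f))"
  have "\<exists>\<sigma>. \<forall>n. I (\<sigma> n) \<and> R n (\<sigma> n) (\<sigma> (Suc n))"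
  proof (rule dependent_nat_choice)
    show "\<exists>p. I p" by (rule exI[of _ "(\<one>\<^bsub>?G\<^esub>, {})"]) (simp add: I_def)
  next
    fix p n assume "I p"
    then obtain g S where p: "p = (g, S)" "g \<in> carrier ?G" "finite S" "S \<subseteq> mspace m"
      by (auto simp: I_def)
    obtain g' T where g': "g' \<in> carrier ?G" "\<forall>x\<in>S. g' x = g x" and T: "finite T" "T \<subseteq> mspace m"
      and P: "\<forall>f\<in>carrier ?G. (\<forall>x\<in>T. f x = g' x) \<longrightarrow> P n f"
      using step[OF p(2-4), of n] by blast
    let ?S' = "S \<union> T \<union> B n \<union> (inv\<^bsub>?G\<^esub> g') ` B n"
    have "I (g', ?S')"
      using p g' T finB Bm by (auto simp: I_def isometry_groupD subset_iff)
    moreover have "x \<in> g' ` ?S'" if "x \<in> B n" for x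
      using that Bm[of n] g'(1) isometry_group_inv_apply(2)[OF g'(1), of x]
      by (intro image_eqI[of _ _ "(inv\<^bsub>?G\<^esub> g') x"]) auto
    then have "R n p (g', ?S')"
      using p(1) g' P by (auto simp: R_def)
    ultimately show "\<exists>q. I q \<and> R n p q" by blast
  qed
  then obtain \<sigma> where I\<sigma>: "\<And>n. I (\<sigma> n)" and R\<sigma>: "\<And>n. R n (\<sigma> n) (\<sigma> (Suc n))" by blast
  define g where "g = (\<lambda>n. fst (\<sigma> n))"
  define S where "S = (\<lambda>n. snd (\<sigma> n))"
  have g: "g n \<in> carrier ?G" and Sm: "S n \<subseteq> mspace m" for n
    using I\<sigma>[of n] by (auto simp: I_def g_def S_def split: prod.splits)
  have agree1: "\<forall>x\<in>S n. g (Suc n) x = g n x" and S_Suc: "S n \<subseteq> S (Suc n)"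
    and BS: "B n \<subseteq> S (Suc n)" and Bg: "B n \<subseteq> g (Suc n) ` S (Suc n)"
    and P: "\<forall>f\<in>carrier ?G. (\<forall>x\<in>S (Suc n). f x = g (Suc n) x) \<longrightarrow> P n f" for n
    using R\<sigma>[of n] by (auto simp: R_def g_def S_def split: prod.splits)
  have S_mono: "S n \<subseteq> S k" if "n \<le> k" for n k
    using that by (rule lift_Suc_mono_le[of S, OF S_Suc])
  have agree: "g k x = g n x" if "n \<le> k" "x \<in> S n" for n k x
    using that
  proof (induction k rule: dec_induct)
    case (step k)
    then have "x \<in> S k" using S_mono by blast
    then show ?case using agree1 step by simp
  qed simp
  have ex_S: "\<exists>n. x \<in> S n" if "x \<in> mspace m" for x
  proof -
    have "x \<in> B (Suc (?N x))" using that by (simp add: B_def)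
    then show ?thesis using BS by blast
  qed
  \<comment> \<open>The values \<open>g n x\<close> are constant from the first \<open>n\<close> with \<open>x \<in> S n\<close> on.\<close>
  define f where "f = (\<lambda>x. g (LEAST n. x \<in> S n) x)"
  have f: "f x = g n x" if "x \<in> S n" for x n
    using agree[OF Least_le[of "\<lambda>n. x \<in> S n", OF that] LeastI[of "\<lambda>n. x \<in> S n", OF that]]
    by (simp add: f_def)
  have iso: "isometric_embedding m m f"
    unfolding isometric_embedding_def
  proof (intro conjI ballI funcsetI)
    fix x assume x: "x \<in> mspace m"
    then obtain n where "x \<in> S n" using ex_S by blast
    then show "f x \<in> mspace m" using f g x by (simp add: isometry_groupD)
    fix y assume y: "y \<in> mspace m"
    then obtain k where "y \<in> S k" using ex_S by blast
    then have "x \<in> S (max n k)" "y \<in> S (max n k)"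
      using \<open>x \<in> S n\<close> S_mono[of n "max n k"] S_mono[of k "max n k"] by auto
    then show "mdist m (f x) (f y) = mdist m x y"
      using f g x y by (simp add: isometry_groupD)
  qed
  have "y \<in> f ` mspace m" if "y \<in> mspace m" for y
  proof -
    have "y \<in> B (Suc (?N y))" using that by (simp add: B_def)
    then obtain x where x: "x \<in> S (Suc (Suc (?N y)))" "y = g (Suc (Suc (?N y))) x"
      using Bg by blast
    then have "y = f x" using f[OF x(1)] by simp
    then show ?thesis using x(1) Sm by blast
  qed
  then have fG: "restrict f (mspace m) \<in> carrier ?G"
    using isometry_groupI[OF iso] by blast
  moreover have "P n (restrict f (mspace m))" for n
    using P[of n] fG f Sm[of "Suc n"] by (auto simp: subset_iff)
  ultimately show thesis by (rule that)
qed

text \<open>Place \<open>A\<close> and its image under \<open>p\<close> so far away from \<open>S\<close> and its image under \<open>g\<close> that all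
  cross-distances are equal. Then \<open>g\<close> on \<open>S\<close> and the conjugate of \<open>p\<close> on the displaced copy of
  \<open>A\<close> do not interact: their union preserves the constant cross-distance, so it is a finite
  partial isometry and extends to an automorphism.\<close>

lemma rational_urysohn_extend_by_conjugate:
  assumes U0: "rational_urysohn_space U0"
    and g: "g \<in> carrier (isometry_group U0)" and S: "finite S" "S \<subseteq> mspace U0"
    and p: "p \<in> carrier (isometry_group U0)" and A: "finite A" "A \<subseteq> mspace U0"
  obtains g' h where "g' \<in> carrier (isometry_group U0)" "h \<in> carrier (isometry_group U0)"
    "\<And>x. x \<in> S \<Longrightarrow> g' x = g x" "\<And>x. x \<in> A \<Longrightarrow> g' (h x) = h (p x)"
proof -
  let ?d = "mdist U0" and ?G = "isometry_group U0"
  interpret group ?G by (rule group_isometry_group)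
  define E where "E = S \<union> g ` S"
  define F where "F = A \<union> p ` A"
  have E: "finite E" "E \<subseteq> mspace U0" and F: "finite F" "F \<subseteq> mspace U0"
    using S A g p by (auto simp: E_def F_def isometry_groupD subset_iff)
  \<comment> \<open>A constant cross-distance \<open>r\<close> satisfies the triangle inequalities as soon as \<open>2 * r\<close> bounds
    the distances within \<open>E\<close> and within \<open>F\<close>; an upper bound of these is a convenient choice.\<close>
  obtain r :: nat where r: "\<And>x y. \<lbrakk>x \<in> E \<union> F; y \<in> E \<union> F\<rbrakk> \<Longrightarrow> ?d x y \<le> real r" and "r > 0"
  proof -
    have fin: "finite ((\<lambda>(x, y). ?d x y) ` ((E \<union> F) \<times> (E \<union> F)))" using E F by blast
    obtain b where b: "\<And>x y. \<lbrakk>x \<in> E \<union> F; y \<in> E \<union> F\<rbrakk> \<Longrightarrow> ?d x y \<le> b"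
      using bdd_above_finite[OF fin]
      unfolding bdd_above_def by fastforce
    obtain r :: nat where "b < real r" using reals_Archimedean2 by blast
    then have le: "?d x y \<le> real (Suc r)" if "x \<in> E \<union> F" "y \<in> E \<union> F" for x y
      using b[OF that] by simp
    show ?thesis by (rule that[of "Suc r", OF le]) auto
  qed
  obtain h where h: "h \<in> carrier ?G"
    and hr: "\<And>x y. \<lbrakk>x \<in> E; y \<in> F\<rbrakk> \<Longrightarrow> ?d x (h y) = real r"
  proof (rule rational_urysohn_prescribed_distances[OF U0 E F, of "\<lambda>_ _. real r"])
    show "?d x x' \<le> real r + real r" if "x \<in> E" "x' \<in> E" for x x'
      using r[of x x'] that by simp
    show "?d y y' \<le> real r + real r" if "y \<in> F" "y' \<in> F" for y y'
      using r[of y y'] that by simp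
  qed (use \<open>r > 0\<close> in auto)
  define k where "k = h \<otimes>\<^bsub>?G\<^esub> p \<otimes>\<^bsub>?G\<^esub> inv\<^bsub>?G\<^esub> h"
  have k: "k \<in> carrier ?G" using h p by (simp add: k_def)
  have kh: "k (h x) = h (p x)" if "x \<in> A" for x
    using isometry_group_conjugate_apply[OF p h] that A by (auto simp: k_def)
  define q where "q = (\<lambda>z. if z \<in> S then g z else k z)"
  have hA: "h ` A \<subseteq> mspace U0" using A h by (auto simp: isometry_groupD subset_iff)
  have far: "?d z (h x) = real r" "?d (g z) (k (h x)) = real r" if "z \<in> S" "x \<in> A" for z x
    using that hr kh by (auto simp: E_def F_def)
  have disj: "h x \<notin> S" if "x \<in> A" for x
    using far(1)[of "h x" x] that hA \<open>r > 0\<close> by (auto simp: image_subset_iff mdist_self)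
  obtain g' where g': "g' \<in> carrier ?G" "\<And>z. z \<in> S \<union> h ` A \<Longrightarrow> g' z = q z"
  proof (rule rational_urysohn_homogeneous[OF U0, of "S \<union> h ` A" q])
    show "q \<in> S \<union> h ` A \<rightarrow> mspace U0"
      using S hA g k by (auto simp: q_def isometry_groupD subset_iff)
    fix x y assume xy: "x \<in> S \<union> h ` A" "y \<in> S \<union> h ` A"
    then have m: "x \<in> mspace U0" "y \<in> mspace U0" using S hA by auto
    show "?d (q x) (q y) = ?d x y"
    proof (cases "x \<in> S"; cases "y \<in> S")
      assume "x \<in> S" "y \<notin> S"
      then show ?thesis using xy far by (auto simp: q_def)
    next
      assume "x \<notin> S" "y \<in> S"
      then show ?thesis using xy far by (auto simp: q_def mdist_commute)
    qed (use m g k in \<open>auto simp: q_def isometry_groupD\<close>)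
  qed (use S A hA in auto)
  show thesis
  proof (rule that[OF g'(1) h])
    show "g' x = g x" if "x \<in> S" for x using g' that by (simp add: q_def)
    show "g' (h x) = h (p x)" if "x \<in> A" for x
      using g'(2)[of "h x"] that disj kh by (simp add: q_def)
  qed
qed

text \<open>The countably many properties to be met by \<open>g\<close> are indexed by the graphs of the finite
  partial isometries. Quantifying over graphs instead of maps is what makes the index set
  countable.\<close>

theorem rational_urysohn_dense_conjugacy_class:
  assumes U0: "rational_urysohn_space U0"
  shows "has_dense_conjugacy_class (isometry_group U0)
           (pointwise_topology U0 (discrete_topology (mspace U0)))"
proof -
  let ?G = "isometry_group U0"
  interpret group ?G by (rule group_isometry_group)
  define graphs where
    "graphs = {(\<lambda>x. (x, f x)) ` A | f A. f \<in> carrier ?G \<and> finite A \<and> A \<subseteq> mspace U0}"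
  have cnt: "countable (mspace U0)" using U0 by (simp add: rational_urysohn_space_def)
  have "graphs \<subseteq> {P. finite P \<and> P \<subseteq> mspace U0 \<times> mspace U0}"
    by (auto simp: graphs_def isometry_groupD subset_iff)
  moreover have "countable {P. finite P \<and> P \<subseteq> mspace U0 \<times> mspace U0}"
    using cnt by (intro countable_Collect_finite_subset countable_SIGMA)
  ultimately have "countable graphs" by (rule countable_subset)
  moreover have "graphs \<noteq> {}" using one_closed by (force simp: graphs_def)
  ultimately have rng: "range (from_nat_into graphs) = graphs"
    by (simp add: range_from_nat_into)
  obtain g where g: "g \<in> carrier ?G"
    and gP: "\<And>n. \<exists>h\<in>carrier ?G. \<forall>(x, y)\<in>from_nat_into graphs n. g (h x) = h y"
  proof (rule countable_metric_generic_isometry[OF cnt,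
        of "\<lambda>n f. \<exists>h\<in>carrier ?G. \<forall>(x, y)\<in>from_nat_into graphs n. f (h x) = h y"])
    fix n g S
    assume gS: "g \<in> carrier ?G" "finite S" "S \<subseteq> mspace U0"
    have "from_nat_into graphs n \<in> graphs" using rng by blast
    then obtain p A where pA: "from_nat_into graphs n = (\<lambda>x. (x, p x)) ` A"
      "p \<in> carrier ?G" "finite A" "A \<subseteq> mspace U0"
      by (auto simp: graphs_def)
    obtain g' h where g': "g' \<in> carrier ?G" "h \<in> carrier ?G"
      "\<And>x. x \<in> S \<Longrightarrow> g' x = g x" "\<And>x. x \<in> A \<Longrightarrow> g' (h x) = h (p x)"
      using rational_urysohn_extend_by_conjugate[OF U0 gS pA(2-4)] by blast
    have "finite (h ` A)" "h ` A \<subseteq> mspace U0"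
      using pA g'(2) by (auto simp: isometry_groupD subset_iff)
    moreover have "\<exists>h\<in>carrier ?G. \<forall>(x, y)\<in>from_nat_into graphs n. f (h x) = h y"
      if "\<forall>x\<in>h ` A. f x = g' x" for f
      using that g' pA(1) by (intro bexI[of _ h]) auto
    ultimately show "\<exists>g'\<in>carrier ?G. \<exists>T. finite T \<and> T \<subseteq> mspace U0 \<and> (\<forall>x\<in>S. g' x = g x) \<and>
        (\<forall>f\<in>carrier ?G. (\<forall>x\<in>T. f x = g' x) \<longrightarrow>
          (\<exists>h\<in>carrier ?G. \<forall>(x, y)\<in>from_nat_into graphs n. f (h x) = h y))"
      using g'(1,3) by (intro bexI[of _ g'] exI[of _ "h ` A"]) auto
  qed blast
  have "pointwise_topology U0 (discrete_topology (mspace U0)) closure_of (conjugacy_class ?G g)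
      = topspace (pointwise_topology U0 (discrete_topology (mspace U0)))"
  proof (rule dense_in_pointwise_topologyI)
    show "conjugacy_class ?G g \<subseteq> carrier ?G" using g by (auto simp: conjugacy_class_def)
    fix f A U
    assume f: "f \<in> carrier ?G" and A: "finite A" "A \<subseteq> mspace U0"
      and U: "\<And>x. x \<in> A \<Longrightarrow> openin (discrete_topology (mspace U0)) (U x) \<and> f x \<in> U x"
    have "(\<lambda>x. (x, f x)) ` A \<in> graphs" using f A by (auto simp: graphs_def)
    then obtain n where n: "from_nat_into graphs n = (\<lambda>x. (x, f x)) ` A"
      using rng by (metis imageE)
    obtain h where h: "h \<in> carrier ?G" "\<forall>x\<in>A. g (h x) = h (f x)"
      using gP[of n] unfolding n by auto
    \<comment> \<open>As \<open>g\<close> contains the conjugate by \<open>h\<close> of \<open>f\<close> on \<open>A\<close>, conjugating \<open>g\<close> back by the inverse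
      of \<open>h\<close> gives a map that agrees with \<open>f\<close> on \<open>A\<close>.\<close>
    let ?c = "inv\<^bsub>?G\<^esub> h \<otimes>\<^bsub>?G\<^esub> g \<otimes>\<^bsub>?G\<^esub> inv\<^bsub>?G\<^esub> (inv\<^bsub>?G\<^esub> h)"
    have "?c x = f x" if "x \<in> A" for x
    proof -
      have x: "x \<in> mspace U0" "h x \<in> mspace U0" "f x \<in> mspace U0"
        using that A h f by (auto simp: isometry_groupD)
      then have "?c x = (inv\<^bsub>?G\<^esub> h) (g (h x))"
        using isometry_group_conjugate_apply[OF g inv_closed[OF h(1)] x(2)] h
        by (simp add: isometry_group_inv_apply)
      then show ?thesis using h that x by (simp add: isometry_group_inv_apply)
    qed
    moreover have "?c \<in> conjugacy_class ?G g" unfolding conjugacy_class_def using inv_closed[OF h(1)] by blast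
    ultimately show "\<exists>k\<in>conjugacy_class ?G g. \<forall>x\<in>A. k x \<in> U x"
      using U by metis
  qed simp
  then show ?thesis using g by (auto simp: has_dense_conjugacy_class_def)
qed

section \<open>Extending isometries to a completion\<close>

lemma isometric_embedding_imp_Lipschitz:
  "isometric_embedding m m' f \<Longrightarrow> Lipschitz_continuous_map m m' f"
  unfolding Lipschitz_continuous_map_def isometric_embedding_def
  by (intro conjI exI[of _ 1]) auto

lemma isometric_embedding_compose:
  "\<lbrakk>isometric_embedding m m' f; isometric_embedding m' m'' g\<rbrakk>
     \<Longrightarrow> isometric_embedding m m'' (g \<circ> f)"
  by (auto simp: isometric_embedding_def Pi_iff)

lemma isometric_embedding_continuous:
  "isometric_embedding m m' f \<Longrightarrow> continuous_map (mtopology_of m) (mtopology_of m') f"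
  by (intro Lipschitz_continuous_imp_continuous_map isometric_embedding_imp_Lipschitz)

lemma isometric_embedding_determined_on_dense:
  assumes "isometric_embedding M M' f" "isometric_embedding M M' g"
    and dense: "mtopology_of M closure_of S = mspace M"
    and eq: "\<And>x. x \<in> S \<Longrightarrow> f x = g x" and x: "x \<in> mspace M"
  shows "f x = g x"
proof (rule forall_in_closure_of_eq[where X = "mtopology_of M" and Y = "mtopology_of M'" and S = S])
  show "Hausdorff_space (mtopology_of M')"
    by (simp add: Metric_space.Hausdorff_space_mtopology mtopology_of_def)
qed (use assms in \<open>auto intro: isometric_embedding_continuous\<close>)

text \<open>The Lipschitz extension theorem gives a continuous extension \<open>F\<close>, which is isometric by
  continuity of the distance, applied to one argument at a time.\<close>

lemma isometric_embedding_extends_from_dense: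
  assumes M': "mcomplete_of M'"
    and dense: "mtopology_of M closure_of S = mspace M" and S: "S \<subseteq> mspace M"
    and f: "isometric_embedding (submetric M S) M' f"
  obtains F where "isometric_embedding M M' F" "\<And>x. x \<in> S \<Longrightarrow> F x = f x"
proof -
  obtain F where lip: "Lipschitz_continuous_map (submetric M (mspace M)) M' F"
    and F: "\<And>x. x \<in> S \<Longrightarrow> F x = f x"
    using Lipschitz_continuous_map_extends_to_closure_of[OF M' isometric_embedding_imp_Lipschitz[OF f]]
      dense by auto
  have FM: "F \<in> mspace M \<rightarrow> mspace M'"
    using Lipschitz_continuous_map_image[OF lip] by simp
  have cont: "continuous_map (mtopology_of M) (mtopology_of M') F"
    using Lipschitz_continuous_imp_continuous_map[OF lip] by simp
  have cont_dist: "continuous_map (mtopology_of M) euclideanreal (\<lambda>x. mdist M' (F x) (F y))"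
    "continuous_map (mtopology_of M) euclideanreal (\<lambda>x. mdist M x y)"
    if "y \<in> mspace M" for y
    using that FM by (auto intro!: continuous_map_mdist cont)
  have on_S: "mdist M' (F x) (F y) = mdist M x y" if "x \<in> S" "y \<in> S" for x y
    using f that F S by (auto simp: isometric_embedding_def subset_iff)
  have half: "mdist M' (F x) (F y) = mdist M x y" if x: "x \<in> mspace M" and y: "y \<in> S" for x y
    by (rule forall_in_closure_of_eq[where X = "mtopology_of M" and S = S and Y = euclideanreal
          and f = "\<lambda>x. mdist M' (F x) (F y)" and g = "\<lambda>x. mdist M x y"])
       (use x y dense S on_S cont_dist in auto)
  have half': "mdist M' (F x) (F y) = mdist M x y" if x: "x \<in> S" and y: "y \<in> mspace M" for x y
    using half[OF y x] by (simp add: mdist_commute)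
  have "mdist M' (F x) (F y) = mdist M x y" if x: "x \<in> mspace M" and y: "y \<in> mspace M" for x y
    by (rule forall_in_closure_of_eq[where X = "mtopology_of M" and S = S and Y = euclideanreal
          and f = "\<lambda>x. mdist M' (F x) (F y)" and g = "\<lambda>x. mdist M x y"])
       (use x y dense half' cont_dist in auto)
  then have "isometric_embedding M M' F" using FM by (simp add: isometric_embedding_def)
  then show thesis using F by (rule that)
qed

text \<open>The extensions of \<open>g\<close> and of its inverse compose to the identity on a dense set, hence
  everywhere, so the extension of \<open>g\<close> is surjective.\<close>

lemma isometry_extends_to_completion:
  assumes M: "mcomplete_of M" and e: "isometric_embedding m M e"
    and dense: "mtopology_of M closure_of (e ` mspace m) = mspace M"
    and g: "g \<in> carrier (isometry_group m)"
  shows "\<exists>!f. f \<in> carrier (isometry_group M) \<and> (\<forall>x\<in>mspace m. f (e x) = e (g x))"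
proof -
  interpret group "isometry_group m" by (rule group_isometry_group)
  let ?S = "e ` mspace m"
  have S: "?S \<subseteq> mspace M" using e by (auto simp: isometric_embedding_def)
  have ext: "\<exists>F. isometric_embedding M M F \<and> (\<forall>x\<in>mspace m. F (e x) = e (k x))"
    if k: "k \<in> carrier (isometry_group m)" for k
  proof -
    let ?e' = "inv_into (mspace m) e"
    have e': "?e' (e x) = x" if "x \<in> mspace m" for x
      using isometric_embedding_inj_on[OF e] that by simp
    have "isometric_embedding (submetric M ?S) M (\<lambda>z. e (k (?e' z)))"
      using e k e' isometry_groupD[OF k] by (auto simp: isometric_embedding_def Pi_iff)
    then obtain F where "isometric_embedding M M F" "\<And>z. z \<in> ?S \<Longrightarrow> F z = e (k (?e' z))"
      using isometric_embedding_extends_from_dense[OF M dense S] by blast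
    then show ?thesis using e' by auto
  qed
  obtain F where F: "isometric_embedding M M F" "\<forall>x\<in>mspace m. F (e x) = e (g x)"
    using ext[OF g] by blast
  obtain F' where F': "isometric_embedding M M F'"
    "\<forall>x\<in>mspace m. F' (e x) = e ((inv\<^bsub>isometry_group m\<^esub> g) x)"
    using ext[OF inv_closed[OF g]] by blast
  have "(F \<circ> F') z = id z" if "z \<in> mspace M" for z
  proof (rule isometric_embedding_determined_on_dense[OF _ _ dense _ that])
    show "isometric_embedding M M (F \<circ> F')" using F F' by (blast intro: isometric_embedding_compose)
    show "isometric_embedding M M id" by (simp add: isometric_embedding_def)
    fix z assume "z \<in> ?S"
    then show "(F \<circ> F') z = id z"
      using F(2) F'(2) isometry_groupD(1)[OF inv_closed[OF g]] isometry_group_inv_apply[OF g] by auto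
  qed
  then have "mspace M \<subseteq> F ` mspace M"
    using F'(1) by (force simp: isometric_embedding_def)
  then have "restrict F (mspace M) \<in> carrier (isometry_group M)"
    using F(1) by (intro isometry_groupI)
  moreover have "\<forall>x\<in>mspace m. restrict F (mspace M) (e x) = e (g x)"
    using F(2) S by auto
  moreover have "f = f'"
    if "f \<in> carrier (isometry_group M) \<and> (\<forall>x\<in>mspace m. f (e x) = e (g x))"
      "f' \<in> carrier (isometry_group M) \<and> (\<forall>x\<in>mspace m. f' (e x) = e (g x))" for f f'
  proof (rule isometry_group_eqI)
    show "f x = f' x" if "x \<in> mspace M" for x
      by (rule isometric_embedding_determined_on_dense[OF _ _ dense _ that])
         (use \<open>f \<in> _ \<and> _\<close> \<open>f' \<in> _ \<and> _\<close> in \<open>auto simp: isometry_group_carrier_iff\<close>)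
  qed (use that in auto)
  ultimately show ?thesis by blast
qed

lemma metric_dense_approx:
  assumes dense: "mtopology_of M closure_of S = mspace M" and "y \<in> mspace M" "\<epsilon> > 0"
  obtains x where "x \<in> S" "x \<in> mspace M" "mdist M y x < \<epsilon>"
proof -
  interpret Metric_space "mspace M" "mdist M" by simp
  show thesis
    using assms that unfolding mtopology_of_def metric_closure_of by fastforce
qed

text \<open>A map \<open>w\<close> that distorts distances by at most \<open>2 * \<delta>\<close> is within \<open>\<delta>\<close> of an automorphism. Join
  \<open>F\<close> to its image by edges of length \<open>\<delta>\<close> between \<open>x\<close> and \<open>w x\<close>; the cross-distance \<open>c\<close> is the
  resulting shortest-path distance. The bound on the distortion says that a detour through two
  such edges never shortens a distance within \<open>F\<close> or within its image.\<close>

lemma rational_urysohn_approximate_isometry: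
  assumes U0: "rational_urysohn_space U0" and F: "finite F" "F \<subseteq> mspace U0"
    and w: "w \<in> F \<rightarrow> mspace U0" and \<delta>: "\<delta> \<in> \<rat>" "\<delta> > 0"
    and near: "\<And>x y. \<lbrakk>x \<in> F; y \<in> F\<rbrakk> \<Longrightarrow> \<bar>mdist U0 (w x) (w y) - mdist U0 x y\<bar> \<le> 2 * \<delta>"
  obtains h where "h \<in> carrier (isometry_group U0)" "\<And>x. x \<in> F \<Longrightarrow> mdist U0 (w x) (h x) \<le> \<delta>"
proof -
  let ?d = "mdist U0"
  \<comment> \<open>\<open>b u x z\<close> is the length of the path from \<open>u\<close> to \<open>x\<close> that crosses at \<open>z\<close>.\<close>
  define b where "b = (\<lambda>u x z. ?d u (w z) + \<delta> + ?d z x)"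
  define c where "c = (\<lambda>u x. Min (b u x ` F))"
  have wm: "w x \<in> mspace U0" and Fm: "x \<in> mspace U0" if "x \<in> F" for x
    using w F that by auto
  have E: "finite (w ` F)" "w ` F \<subseteq> mspace U0" using F w by auto
  have rat: "?d x y \<in> \<rat>" if "x \<in> mspace U0" "y \<in> mspace U0" for x y
    using U0 that by (auto simp: rational_urysohn_space_def rational_metric_def)
  have c_le: "c u x \<le> b u x z" if "z \<in> F" for u x z
    using that F by (simp add: c_def)
  have c_eq: "\<exists>z\<in>F. c u x = b u x z" if "x \<in> F" for u x
  proof -
    have "Min (b u x ` F) \<in> b u x ` F" using that F by (intro Min_in) auto
    then show ?thesis by (auto simp: c_def)
  qed
  have tri: "?d x z \<le> ?d x y + ?d y z"
    if "x \<in> mspace U0" "y \<in> mspace U0" "z \<in> mspace U0" for x y z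
    using that by (rule mdist_triangle)
  note com = mdist_commute[of U0]
  obtain h where h: "h \<in> carrier (isometry_group U0)"
    and hc: "\<And>u x. \<lbrakk>u \<in> w ` F; x \<in> F\<rbrakk> \<Longrightarrow> ?d u (h x) = c u x"
  proof (rule rational_urysohn_prescribed_distances[OF U0 E F, of c])
    fix u x assume u: "u \<in> w ` F" and x: "x \<in> F"
    then have um: "u \<in> mspace U0" using E by auto
    obtain z where z: "z \<in> F" "c u x = b u x z" using c_eq x by blast
    have "b u x z \<in> \<rat>"
      unfolding b_def using um wm[OF z(1)] Fm[OF z(1)] Fm[OF x] \<delta>(1) by (intro Rats_add rat)
    moreover have "0 < b u x z"
      unfolding b_def
      using \<delta>(2) mdist_nonneg[of U0 u "w z"] mdist_nonneg[of U0 z x] by linarith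
    ultimately show "c u x \<in> \<rat> \<and> 0 < c u x" using z(2) by simp
  next
    fix u u' x assume u: "u \<in> w ` F" "u' \<in> w ` F" and x: "x \<in> F"
    then have um: "u \<in> mspace U0" "u' \<in> mspace U0" using E by auto
    obtain z where z: "z \<in> F" "c u' x = b u' x z" using c_eq x by blast
    have "c u x \<le> b u x z" using c_le z by blast
    also have "\<dots> \<le> ?d u u' + b u' x z" using tri[of u u' "w z"] um wm z by (simp add: b_def)
    finally show "c u x \<le> ?d u u' + c u' x" using z by simp
  next
    fix u x x' assume u: "u \<in> w ` F" and x: "x \<in> F" "x' \<in> F"
    obtain z where z: "z \<in> F" "c u x' = b u x' z" using c_eq x by blast
    have "c u x \<le> b u x z" using c_le z by blast
    also have "\<dots> \<le> b u x' z + ?d x' x" using tri[of z x' x] Fm x z by (simp add: b_def)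
    finally show "c u x \<le> c u x' + ?d x' x" using z by simp
  next
    fix u u' x assume u: "u \<in> w ` F" "u' \<in> w ` F" and x: "x \<in> F"
    then have um: "u \<in> mspace U0" "u' \<in> mspace U0" using E by auto
    obtain z where z: "z \<in> F" "c u x = b u x z" using c_eq x by blast
    obtain z' where z': "z' \<in> F" "c u' x = b u' x z'" using c_eq x by blast
    have "?d u u' \<le> ?d u (w z) + ?d (w z) (w z') + ?d u' (w z')"
      using tri[of u "w z" u'] tri[of "w z" "w z'" u'] um wm z z' com by simp
    also have "?d (w z) (w z') \<le> 2 * \<delta> + ?d z x + ?d z' x"
      using near[of z z'] tri[of z x z'] Fm x z z' com by fastforce
    finally show "?d u u' \<le> c u x + c u' x" using z z' by (simp add: b_def)
  next
    fix u x x' assume u: "u \<in> w ` F" and x: "x \<in> F" "x' \<in> F"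
    then have um: "u \<in> mspace U0" using E by auto
    obtain z where z: "z \<in> F" "c u x = b u x z" using c_eq x by blast
    obtain z' where z': "z' \<in> F" "c u x' = b u x' z'" using c_eq x by blast
    have "?d x x' \<le> ?d z x + ?d z z' + ?d z' x'"
      using tri[of x z x'] tri[of z z' x'] Fm x z z' com by simp
    also have "?d z z' \<le> 2 * \<delta> + ?d u (w z) + ?d u (w z')"
      using near[of z z'] tri[of "w z" u "w z'"] um wm z z' com by fastforce
    finally show "?d x x' \<le> c u x + c u x'" using z z' by (simp add: b_def)
  qed blast
  have "?d (w x) (h x) \<le> \<delta>" if x: "x \<in> F" for x
    using hc[of "w x" x] c_le[OF x, of "w x" x] x wm Fm by (simp add: b_def mdist_self)
  with h show thesis by (rule that)
qed

text \<open>Approximate the points \<open>f (e x)\<close> by points \<open>w x\<close> of the dense copy of \<open>U0\<close>. Since \<open>f\<close> is an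
  isometry, \<open>w\<close> almost preserves distances and is itself close to an automorphism.\<close>

lemma rational_urysohn_isometry_near_completion_isometry:
  assumes U0: "rational_urysohn_space U0" and e: "isometric_embedding U0 U e"
    and dense: "mtopology_of U closure_of (e ` mspace U0) = mspace U"
    and f: "f \<in> carrier (isometry_group U)"
    and F: "finite F" "F \<subseteq> mspace U0" and "\<epsilon> > 0"
  obtains g where "g \<in> carrier (isometry_group U0)"
    "\<And>x. x \<in> F \<Longrightarrow> mdist U (f (e x)) (e (g x)) < \<epsilon>"
proof -
  let ?d = "mdist U"
  have em: "e x \<in> mspace U" if "x \<in> mspace U0" for x
    using e that by (auto simp: isometric_embedding_def)
  have ed: "?d (e x) (e y) = mdist U0 x y" if "x \<in> mspace U0" "y \<in> mspace U0" for x y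
    using e that by (auto simp: isometric_embedding_def)
  \<comment> \<open>Two errors of size \<open>\<delta>\<close> add up: from \<open>f (e x)\<close> to \<open>e (w x)\<close> and from there to \<open>e (g x)\<close>.\<close>
  obtain \<delta> where \<delta>: "\<delta> \<in> \<rat>" "0 < \<delta>" "\<delta> < \<epsilon> / 2"
    using Rats_dense_in_real[of 0 "\<epsilon> / 2"] \<open>\<epsilon> > 0\<close> by auto
  have "\<exists>y\<in>mspace U0. ?d (f (e x)) (e y) < \<delta>" if "x \<in> F" for x
  proof -
    have "f (e x) \<in> mspace U" using that F em f by (auto simp: isometry_groupD)
    then show ?thesis using metric_dense_approx[OF dense _ \<delta>(2)] by blast
  qed
  then obtain w where w: "\<And>x. x \<in> F \<Longrightarrow> w x \<in> mspace U0 \<and> ?d (f (e x)) (e (w x)) < \<delta>"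
    by metis
  have m: "x \<in> mspace U0" "f (e x) \<in> mspace U" "e (w x) \<in> mspace U" if "x \<in> F" for x
    using that F w em f by (auto simp: isometry_groupD)
  have near: "\<bar>mdist U0 (w x) (w y) - mdist U0 x y\<bar> \<le> 2 * \<delta>" if "x \<in> F" "y \<in> F" for x y
  proof -
    have "mdist U0 x y = ?d (f (e x)) (f (e y))"
      using that F em f ed by (auto simp: isometry_groupD subset_iff)
    moreover have "mdist U0 (w x) (w y) = ?d (e (w x)) (e (w y))"
      using that w ed by simp
    ultimately show ?thesis
      using w[OF that(1)] w[OF that(2)] m[OF that(1)] m[OF that(2)]
        mdist_triangle[of "f (e x)" U "e (w x)" "f (e y)"]
        mdist_triangle[of "e (w x)" U "e (w y)" "f (e y)"]
        mdist_triangle[of "e (w x)" U "f (e x)" "e (w y)"]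
        mdist_triangle[of "f (e x)" U "f (e y)" "e (w y)"]
        mdist_commute[of U] by (smt (verit))
  qed
  obtain g where g: "g \<in> carrier (isometry_group U0)" "\<And>x. x \<in> F \<Longrightarrow> mdist U0 (w x) (g x) \<le> \<delta>"
    using rational_urysohn_approximate_isometry[OF U0 F _ \<delta>(1,2) near] w by blast
  have "?d (f (e x)) (e (g x)) < \<epsilon>" if x: "x \<in> F" for x
  proof -
    have gx: "g x \<in> mspace U0" using g(1) m(1)[OF x] by (rule isometry_groupD)
    have "?d (f (e x)) (e (g x)) \<le> ?d (f (e x)) (e (w x)) + ?d (e (w x)) (e (g x))"
      using m[OF x] em[OF gx] by (intro mdist_triangle)
    also have "\<dots> < \<delta> + \<delta>"
      using w[OF x] ed[of "w x" "g x"] gx g(2)[OF x] by simp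
    finally show ?thesis using \<delta>(3) by simp
  qed
  with g(1) show thesis by (rule that)
qed

text \<open>The embedding sends an automorphism to its unique extension. It is continuous although
  \<open>U0\<close> is discrete and \<open>U\<close> is not: if two automorphisms agree at a point near \<open>y\<close>, their
  extensions are close at \<open>y\<close>. For density, a point \<open>y\<close> of \<open>U\<close> is replaced by a nearby point of
  \<open>U0\<close>, which changes values of isometries by no more than the distance of the two points.\<close>

theorem rational_urysohn_isometries_embed_in_completion:
  assumes U0: "rational_urysohn_space U0" and U: "is_completion U0 U"
  shows "continuously_densely_embeds
           (isometry_group U0) (pointwise_topology U0 (discrete_topology (mspace U0)))
           (isometry_group U) (pointwise_topology U (mtopology_of U))"
proof -
  let ?G = "isometry_group U0" and ?H = "isometry_group U" and ?d = "mdist U"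
  let ?S = "pointwise_topology U0 (discrete_topology (mspace U0))"
  interpret G: group ?G by (rule group_isometry_group)
  interpret H: group ?H by (rule group_isometry_group)
  obtain e where M: "mcomplete_of U" and e: "isometric_embedding U0 U e"
    and dense: "mtopology_of U closure_of (e ` mspace U0) = mspace U"
    using U by (auto simp: is_completion_def)
  have em: "e x \<in> mspace U" if "x \<in> mspace U0" for x
    using e that by (auto simp: isometric_embedding_def)
  note ext = isometry_extends_to_completion[OF M e dense]
  define \<phi> where
    "\<phi> = (\<lambda>g. THE f. f \<in> carrier ?H \<and> (\<forall>x\<in>mspace U0. f (e x) = e (g x)))"
  have \<phi>: "\<phi> g \<in> carrier ?H" "\<And>x. x \<in> mspace U0 \<Longrightarrow> \<phi> g (e x) = e (g x)"
    if "g \<in> carrier ?G" for g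
    using theI'[OF ext[OF that]] by (auto simp: \<phi>_def)
  have \<phi>_unique: "f = \<phi> g"
    if "g \<in> carrier ?G" "f \<in> carrier ?H" "\<And>x. x \<in> mspace U0 \<Longrightarrow> f (e x) = e (g x)" for f g
    using ext[OF that(1)] \<phi>[OF that(1)] that by blast
  have hom: "\<phi> \<in> hom ?G ?H"
  proof (rule homI)
    fix g h assume gh: "g \<in> carrier ?G" "h \<in> carrier ?G"
    show "\<phi> (g \<otimes>\<^bsub>?G\<^esub> h) = \<phi> g \<otimes>\<^bsub>?H\<^esub> \<phi> h"
      using gh \<phi> em
      by (intro \<phi>_unique[symmetric]) (auto simp: isometry_group_mult_apply isometry_groupD)
  qed (use \<phi> in auto)
  have inj: "inj_on \<phi> (carrier ?G)"
  proof (rule inj_onI)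
    fix g h assume gh: "g \<in> carrier ?G" "h \<in> carrier ?G" "\<phi> g = \<phi> h"
    show "g = h"
    proof (rule isometry_group_eqI[OF gh(1,2)])
      fix x assume x: "x \<in> mspace U0"
      then have "e (g x) = e (h x)" using gh \<phi> by metis
      then show "g x = h x"
        using isometric_embedding_inj_on[OF e] x gh by (auto simp: isometry_groupD dest: inj_onD)
    qed
  qed
  have move: "?d (\<phi> g y) (\<phi> g (e x)) = ?d y (e x)"
    if "g \<in> carrier ?G" "y \<in> mspace U" "x \<in> mspace U0" for g y x
    using isometry_groupD(2)[OF \<phi>(1)[OF that(1)] that(2) em[OF that(3)]] .
  have tri: "?d x z \<le> ?d x y + ?d y z" if "x \<in> mspace U" "y \<in> mspace U" "z \<in> mspace U" for x y z
    using that by (rule mdist_triangle)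
  have topS: "topspace ?S = carrier ?G" by (simp add: topspace_pointwise_topology)
  have cont: "continuous_map ?S (pointwise_topology U (mtopology_of U)) \<phi>"
    unfolding pointwise_topology_def[of U] continuous_map_in_subtopology continuous_map_componentwise
  proof (intro conjI ballI)
    show "\<phi> ` topspace ?S \<subseteq> extensional (mspace U)"
      using \<phi>(1) topS by (auto simp: isometry_group_carrier_iff)
    show "\<phi> \<in> topspace ?S \<rightarrow> carrier ?H" using \<phi>(1) topS by auto
    fix y assume y: "y \<in> mspace U"
    interpret U: Metric_space "mspace U" "mdist U" by simp
    show "continuous_map ?S (mtopology_of U) (\<lambda>g. \<phi> g y)"
      unfolding mtopology_of_def U.continuous_map_to_metric
    proof (intro ballI allI impI)
      fix g and \<epsilon> :: real assume "g \<in> topspace ?S" and "\<epsilon> > 0"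
      then have g: "g \<in> carrier ?G" using topS by simp
      obtain x where x: "x \<in> mspace U0" "?d y (e x) < \<epsilon> / 2"
        using metric_dense_approx[OF dense y, of "\<epsilon> / 2"] \<open>\<epsilon> > 0\<close> by auto
      define V where "V = {k \<in> topspace ?S. k x \<in> {g x}}"
      have "continuous_map ?S (discrete_topology (mspace U0)) (\<lambda>k. k x)"
        unfolding pointwise_topology_def using x(1)
        by (intro continuous_map_from_subtopology continuous_map_product_projection)
      then have "openin ?S V"
        unfolding V_def using g x(1)
        by (intro openin_continuous_map_preimage) (auto simp: isometry_groupD)
      moreover have "g \<in> V" using g topS by (simp add: V_def)
      moreover have "\<phi> k y \<in> U.mball (\<phi> g y) \<epsilon>" if "k \<in> V" for k
      proof -
        have k: "k \<in> carrier ?G" "k x = g x" using that topS by (auto simp: V_def)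
        have "\<phi> k (e x) = \<phi> g (e x)" using k g x \<phi> by simp
        then have "?d (\<phi> g y) (\<phi> k y) \<le> ?d (\<phi> g y) (\<phi> g (e x)) + ?d (\<phi> k y) (\<phi> k (e x))"
          using tri[of "\<phi> g y" "\<phi> g (e x)" "\<phi> k y"] g k y em[OF x(1)] \<phi>(1)
          by (simp add: isometry_groupD mdist_commute)
        also have "\<dots> < \<epsilon>" using move g k y x by simp
        finally show ?thesis using g k y \<phi>(1) by (simp add: isometry_groupD)
      qed
      ultimately show "\<exists>V. openin ?S V \<and> g \<in> V \<and> (\<forall>k\<in>V. \<phi> k y \<in> U.mball (\<phi> g y) \<epsilon>)"
        by blast
    qed
  qed
  have "pointwise_topology U (mtopology_of U) closure_of (\<phi> ` carrier ?G)
      = topspace (pointwise_topology U (mtopology_of U))"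
  proof (rule dense_in_pointwise_metric_topologyI)
    show "\<phi> ` carrier ?G \<subseteq> carrier ?H" using \<phi>(1) by blast
    fix f A and \<epsilon> :: real
    assume f: "f \<in> carrier ?H" and A: "finite A" "A \<subseteq> mspace U" and \<epsilon>: "\<epsilon> > 0"
    have "\<exists>x\<in>mspace U0. ?d y (e x) < \<epsilon> / 3" if "y \<in> A" for y
      using metric_dense_approx[OF dense, of y "\<epsilon> / 3"] that A \<epsilon> by (auto simp: subset_iff)
    then obtain x where x: "\<And>y. y \<in> A \<Longrightarrow> x y \<in> mspace U0 \<and> ?d y (e (x y)) < \<epsilon> / 3"
      by metis
    obtain g where g: "g \<in> carrier ?G"
      "\<And>z. z \<in> x ` A \<Longrightarrow> ?d (f (e z)) (e (g z)) < \<epsilon> / 3"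
      using rational_urysohn_isometry_near_completion_isometry[OF U0 e dense f, of "x ` A" "\<epsilon> / 3"]
        A x \<epsilon> by auto
    have "?d (f y) (\<phi> g y) < \<epsilon>" if y: "y \<in> A" for y
    proof -
      have ym: "y \<in> mspace U" "x y \<in> mspace U0" "e (x y) \<in> mspace U" using y A x em by auto
      have m: "f y \<in> mspace U" "f (e (x y)) \<in> mspace U" "\<phi> g y \<in> mspace U" "\<phi> g (e (x y)) \<in> mspace U"
        using ym f g \<phi>(1) by (auto simp: isometry_groupD)
      have "?d (f y) (f (e (x y))) < \<epsilon> / 3" using x[OF y] ym f by (simp add: isometry_groupD)
      moreover have "?d (f (e (x y))) (\<phi> g (e (x y))) < \<epsilon> / 3"
        using g y ym \<phi> by simp
      moreover have "?d (\<phi> g (e (x y))) (\<phi> g y) < \<epsilon> / 3"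
        using move[OF g(1) ym(1,2)] x[OF y] by (simp add: mdist_commute)
      ultimately show ?thesis
        using tri[OF m(1,2,3)] tri[OF m(2,4,3)] by linarith
    qed
    then show "\<exists>k\<in>\<phi> ` carrier ?G. \<forall>y\<in>A. ?d (f y) (k y) < \<epsilon>" using g(1) by blast
  qed
  with hom inj cont show ?thesis
    by (auto simp: continuously_densely_embeds_def)
qed

section \<open>Dense conjugacy classes for both groups\<close>

theorem theorem2p2:
  fixes U0 :: "'a metric"
  assumes "rational_urysohn_space U0"
  shows "has_dense_conjugacy_class (isometry_group U0)
           (pointwise_topology U0 (discrete_topology (mspace U0)))
       \<and> (\<forall>U :: 'b metric. is_completion U0 U \<longrightarrow>
            continuously_densely_embeds
              (isometry_group U0) (pointwise_topology U0 (discrete_topology (mspace U0)))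
              (isometry_group U) (pointwise_topology U (mtopology_of U))
          \<and> has_dense_conjugacy_class (isometry_group U) (pointwise_topology U (mtopology_of U)))"
proof (intro conjI allI impI)
  show dense: "has_dense_conjugacy_class (isometry_group U0)
      (pointwise_topology U0 (discrete_topology (mspace U0)))"
    using assms by (rule rational_urysohn_dense_conjugacy_class)
  fix U :: "'b metric" assume "is_completion U0 U"
  with assms show emb: "continuously_densely_embeds
      (isometry_group U0) (pointwise_topology U0 (discrete_topology (mspace U0)))
      (isometry_group U) (pointwise_topology U (mtopology_of U))"
    by (rule rational_urysohn_isometries_embed_in_completion)
  show "has_dense_conjugacy_class (isometry_group U) (pointwise_topology U (mtopology_of U))"
    by (rule dense_conjugacy_class_transfer[OF emb dense])
       (simp_all add: group_isometry_group topspace_pointwise_topology)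
qed

end
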